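(* Given a set $P=\{\tau_0,\dots,\tau_{k-1}\}$ of $k$ positive reals, one can compute, in time $O(k^2)$, a 4-robust schedule $X$ whose consistency $c(X,P)$ is minimum among all 4-robust schedules.
   Context: A (contract) schedule is an increasing bi-infinite sequence $X=(x_i)_{i\in\mathbb{Z}}$ of positive reals with $\sum_{j\le i}x_j<\infty$; contracts are executed consecutively and contract $i$ completes at time $\sum_{j\le i}x_j$. For $T>0$, $\ell(X,T)$ is the largest length $x_i$ of a contract completed by time $T$. The robustness of $X$ is $\sup_{T>0}T/\ell(X,T)$; $X$ is $r$-robust if this is at most $r$. Given a prediction set $P$ of possible interruption times, the consistency of $X$ is $c(X,P)=\sup_{\tau\in P}\tau/\ell(X,\tau)$. Every 4-robust schedule has the form $(2^{i+\delta})_{i\in\mathbb{Z}}$ for some $\delta\in[0,1)$ (up to index shift), so a schedule is output by giving $\delta$. *)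

theory Defs
  imports "HOL-Analysis.Infinite_Sum" "HOL-Library.Landau_Symbols" "HOL-Library.Extended_Real"
begin

section \<open>Contract schedules\<close>

definition contract_schedule :: "(int \<Rightarrow> real) \<Rightarrow> bool" where
  "contract_schedule X \<longleftrightarrow>
     strict_mono X \<and> (\<forall>i. 0 < X i) \<and> (\<forall>i. X summable_on {..i})"

definition completion_time :: "(int \<Rightarrow> real) \<Rightarrow> int \<Rightarrow> real" where
  "completion_time X i = (\<Sum>\<^sub>\<infinity>j\<in>{..i}. X j)"

text \<open>For every schedule and every \<open>T > 0\<close> infinitely many contracts are completed by time \<open>T\<close>,
  so \<^const>\<open>Max\<close> is not applicable; the greatest length nevertheless exists.\<close>

definition longest_completed :: "(int \<Rightarrow> real) \<Rightarrow> real \<Rightarrow> real" where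
  "longest_completed X T = (GREATEST l. \<exists>i. l = X i \<and> completion_time X i \<le> T)"

definition robustness :: "(int \<Rightarrow> real) \<Rightarrow> ereal" where
  "robustness X = (SUP T\<in>{0<..}. ereal (T / longest_completed X T))"

definition robust_schedule :: "real \<Rightarrow> (int \<Rightarrow> real) \<Rightarrow> bool" where
  "robust_schedule r X \<longleftrightarrow> contract_schedule X \<and> robustness X \<le> ereal r"

definition consistency :: "(int \<Rightarrow> real) \<Rightarrow> real set \<Rightarrow> ereal" where
  "consistency X P = (SUP \<tau>\<in>P. ereal (\<tau> / longest_completed X \<tau>))"

definition doubling_schedule :: "real \<Rightarrow> int \<Rightarrow> real" where
  "doubling_schedule \<delta> i = 2 powr (of_int i + \<delta>)"


section \<open>A real RAM with unit costs\<close>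

text \<open>A program works on finitely many index registers holding natural numbers and on an unbounded
  array of real cells. Real cells are only addressed through index registers: an operand \<open>a\<close> of an
  operation on reals denotes the cell whose address is stored in index register \<open>a\<close>.
  Besides the field operations and comparisons the machine offers the base-2 logarithm and the
  floor function, which are needed to pass from a time \<open>2 powr (i + \<delta>)\<close> to \<open>\<delta>\<close>. The floor is again
  a real and cannot be used as an address. The only constants are integers.\<close>

datatype binop = Add | Sub | Mul | Div

datatype unop = Copy | Floor | Log2

datatype test = Index_Less nat nat | Real_Less nat nat

datatype com =
    Skip
  | Index_Const nat nat
  | Index_Add nat nat nat
  | Index_Sub nat nat nat
  | Real_Const nat int
  | Real_Un unop nat nat
  | Real_Bin binop nat nat nat
  | Seq com com
  | If_Then_Else test com com
  | While test com

type_synonym state = "(nat \<Rightarrow> nat) \<times> (nat \<Rightarrow> real)"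

fun binop_defined :: "binop \<Rightarrow> real \<Rightarrow> real \<Rightarrow> bool" where
  "binop_defined Div x y \<longleftrightarrow> y \<noteq> 0"
| "binop_defined _ x y \<longleftrightarrow> True"

fun binop_val :: "binop \<Rightarrow> real \<Rightarrow> real \<Rightarrow> real" where
  "binop_val Add x y = x + y"
| "binop_val Sub x y = x - y"
| "binop_val Mul x y = x * y"
| "binop_val Div x y = x / y"

fun unop_defined :: "unop \<Rightarrow> real \<Rightarrow> bool" where
  "unop_defined Log2 x \<longleftrightarrow> 0 < x"
| "unop_defined _ x \<longleftrightarrow> True"

fun unop_val :: "unop \<Rightarrow> real \<Rightarrow> real" where
  "unop_val Copy x = x"
| "unop_val Floor x = of_int \<lfloor>x\<rfloor>"
| "unop_val Log2 x = log 2 x"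

fun test_val :: "test \<Rightarrow> state \<Rightarrow> bool" where
  "test_val (Index_Less a b) (R, M) \<longleftrightarrow> R a < R b"
| "test_val (Real_Less a b) (R, M) \<longleftrightarrow> M (R a) < M (R b)"

text \<open>\<open>exec c s n s'\<close>: started in \<open>s\<close>, program \<open>c\<close> halts in \<open>s'\<close> after \<open>n\<close> steps, where every
  elementary operation and every evaluation of a test counts as one step. There is no execution
  through an undefined operation.\<close>

inductive exec :: "com \<Rightarrow> state \<Rightarrow> nat \<Rightarrow> state \<Rightarrow> bool" where
  Skip: "exec Skip s 1 s"
| Index_Const: "exec (Index_Const a m) (R, M) 1 (R(a := m), M)"
| Index_Add: "exec (Index_Add a b c) (R, M) 1 (R(a := R b + R c), M)"
| Index_Sub: "exec (Index_Sub a b c) (R, M) 1 (R(a := R b - R c), M)"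
| Real_Const: "exec (Real_Const a z) (R, M) 1 (R, M(R a := of_int z))"
| Real_Un: "unop_defined f (M (R b)) \<Longrightarrow>
    exec (Real_Un f a b) (R, M) 1 (R, M(R a := unop_val f (M (R b))))"
| Real_Bin: "binop_defined f (M (R b)) (M (R c)) \<Longrightarrow>
    exec (Real_Bin f a b c) (R, M) 1 (R, M(R a := binop_val f (M (R b)) (M (R c))))"
| Seq: "exec c1 s m s' \<Longrightarrow> exec c2 s' n s'' \<Longrightarrow> exec (Seq c1 c2) s (m + n) s''"
| If_True: "test_val b s \<Longrightarrow> exec c1 s n s' \<Longrightarrow> exec (If_Then_Else b c1 c2) s (Suc n) s'"
| If_False: "\<not> test_val b s \<Longrightarrow> exec c2 s n s' \<Longrightarrow> exec (If_Then_Else b c1 c2) s (Suc n) s'"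
| While_False: "\<not> test_val b s \<Longrightarrow> exec (While b c) s 1 s"
| While_True: "test_val b s \<Longrightarrow> exec c s m s' \<Longrightarrow> exec (While b c) s' n s'' \<Longrightarrow>
    exec (While b c) s (Suc (m + n)) s''"

lemma exec_deterministic:
  assumes "exec c s n t" "exec c s n' t'"
  shows "n = n' \<and> t = t'"
  using assms
proof (induction arbitrary: n' t' rule: exec.induct)
  case (Seq c1 s m s' c2 n s'')
  from Seq.prems Seq.IH show ?case by (cases rule: exec.cases) blast+
next
  case (If_True b s c1 n s' c2)
  from If_True.prems If_True.IH If_True.hyps show ?case by (cases rule: exec.cases) blast+
next
  case (If_False b s c2 n s' c1)
  from If_False.prems If_False.IH If_False.hyps show ?case by (cases rule: exec.cases) blast+
next
  case (While_True b s c m s' n s'')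
  from While_True.prems While_True.IH While_True.hyps show ?case
    by (cases rule: exec.cases) blast+
qed (erule exec.cases; auto)+

text \<open>The number of inputs is passed in index register 0 and the inputs in the first real cells;
  the result is expected in the first real cell.\<close>

definition input_state :: "real list \<Rightarrow> state" where
  "input_state xs =
     ((\<lambda>_. 0)(0 := length xs), (\<lambda>i. if i < length xs then xs ! i else 0))"

definition result :: "state \<Rightarrow> real" where
  "result s = snd s 0"

end

theory Submission
  imports Defs "HOL-Real_Asymp.Real_Asymp"
begin

text \<open>If \<open>X\<close> is 4-robust, its completion times satisfy \<open>S (i + 2) \<le> 4 * (S (i + 1) - S i)\<close>, that is,
  \<open>S i / 2 powi i\<close> is concave on the integers. Being positive it is constant, so \<open>X\<close> is geometric
  with ratio 2. For the schedule with offset \<open>\<delta>\<close>, an interruption at \<open>\<tau>\<close> has ratio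
  \<open>2 powr (1 + frac (log 2 \<tau> - \<delta>))\<close>. Thus the task is to place \<open>\<delta>\<close> on the circle of reals modulo 1
  so that the largest counterclockwise distance to the points \<open>log 2 \<tau>\<close> is as small as possible.
  Rotating \<open>\<delta>\<close> to the next of these points decreases all the distances, so it suffices to compare
  the \<open>k\<close> points themselves, each of which is evaluated in linear time.\<close>

section \<open>Concave sequences on the integers\<close>

lemma int_concave_bounded_below_imp_le:
  fixes f :: "int \<Rightarrow> 'a :: archimedean_field"
  assumes concave: "\<And>i. f (i - 1) + f (i + 1) \<le> 2 * f i" and lower: "\<And>i. c \<le> f i"
  shows "f i \<le> f (i + 1)"
proof (rule ccontr)
  define d where "d = f i - f (i + 1)"
  assume "\<not> f i \<le> f (i + 1)"
  then have "0 < d" by (simp add: d_def)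
  have decrement: "f (i + int n + 1) \<le> f (i + int n) - d" for n
  proof (induction n)
    case 0
    show ?case by (simp add: d_def)
  next
    case (Suc n)
    then show ?case using concave[of "i + int n + 1"] by (simp add: algebra_simps)
  qed
  have linear_decay: "f (i + int n) \<le> f i - of_nat n * d" for n
  proof (induction n)
    case (Suc n)
    then show ?case using decrement[of n] by (simp add: algebra_simps)
  qed simp
  obtain n where "f i - c < of_nat n * d"
    using ex_less_of_nat_mult[OF \<open>0 < d\<close>] by blast
  then show False using linear_decay[of n] lower[of "i + int n"] by (simp add: algebra_simps)
qed

lemma int_concave_bounded_below_imp_const:
  fixes f :: "int \<Rightarrow> 'a :: archimedean_field"
  assumes concave: "\<And>i. f (i - 1) + f (i + 1) \<le> 2 * f i" and lower: "\<And>i. c \<le> f i"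
  shows "f i = f 0"
proof -
  have step: "f (i + 1) = f i" for i
  proof (rule antisym)
    show "f i \<le> f (i + 1)" using concave lower by (rule int_concave_bounded_below_imp_le)
    have "f (- (- i - 1)) \<le> f (- (- i - 1 + 1))"
    proof (rule int_concave_bounded_below_imp_le[where f = "\<lambda>i. f (- i)"])
      show "f (- (i - 1)) + f (- (i + 1)) \<le> 2 * f (- i)" for i
        using concave[of "- i"] by (simp add: minus_diff_commute add.commute)
    qed (rule lower)
    then show "f (i + 1) \<le> f i" by (simp add: add.commute)
  qed
  show ?thesis
  proof (induction i rule: int_induct[where k = 0])
    case (step2 i)
    then show ?case using step[of "i - 1"] by simp
  qed (simp_all add: step)
qed

lemma nonneg_int_sequence_geometric:
  fixes S :: "int \<Rightarrow> 'a :: archimedean_field"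
  assumes "0 < q" and nonneg: "\<And>i. 0 \<le> S i"
    and recurrence: "\<And>i. S (i + 1) + q\<^sup>2 * S (i - 1) \<le> 2 * q * S i"
  shows "S i = S 0 * q powi i"
proof -
  define f where "f i = S i / q powi i" for i
  have "f i = f 0"
  proof (rule int_concave_bounded_below_imp_const)
    fix i
    have "f (i - 1) + f (i + 1) = (S (i + 1) + q\<^sup>2 * S (i - 1)) / q powi (i + 1)"
      using \<open>0 < q\<close> by (simp add: f_def power_int_add power_int_diff power2_eq_square field_simps)
    also have "\<dots> \<le> 2 * q * S i / q powi (i + 1)"
      using \<open>0 < q\<close> by (intro divide_right_mono recurrence) simp
    also have "\<dots> = 2 * f i"
      using \<open>0 < q\<close> by (simp add: f_def power_int_add)
    finally show "f (i - 1) + f (i + 1) \<le> 2 * f i" .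
    show "0 \<le> f i" using \<open>0 < q\<close> nonneg by (simp add: f_def)
  qed
  then show ?thesis using \<open>0 < q\<close> by (simp add: f_def field_simps)
qed


section \<open>Contract schedules\<close>

lemma completion_time_add_1:
  assumes "contract_schedule X"
  shows "completion_time X (i + 1) = completion_time X i + X (i + 1)"
proof -
  have "{..i + 1} = insert (i + 1) {..i}" by auto
  moreover have "X summable_on {..i}" using assms by (simp add: contract_schedule_def)
  ultimately show ?thesis
    unfolding completion_time_def by (simp add: infsum_insert)
qed

lemma completion_time_mono:
  assumes "contract_schedule X" "i \<le> j"
  shows "completion_time X i \<le> completion_time X j"
  unfolding completion_time_def using assms
  by (intro infsum_mono2) (auto simp: contract_schedule_def less_imp_le)

lemma completion_time_pos:
  assumes "contract_schedule X"
  shows "0 < completion_time X i"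
proof -
  have "0 \<le> completion_time X (i - 1)"
    unfolding completion_time_def using assms
    by (intro infsum_nonneg) (simp add: contract_schedule_def less_imp_le)
  moreover have "0 < X i" using assms by (simp add: contract_schedule_def)
  ultimately show ?thesis using completion_time_add_1[OF assms, of "i - 1"] by simp
qed

lemma longest_completed_eq:
  assumes schedule: "contract_schedule X"
    and interval: "completion_time X i \<le> T" "T < completion_time X (i + 1)"
  shows "longest_completed X T = X i"
  unfolding longest_completed_def
proof (rule Greatest_equality)
  show "\<exists>j. X i = X j \<and> completion_time X j \<le> T" using interval by blast
next
  fix l assume "\<exists>j. l = X j \<and> completion_time X j \<le> T"
  then obtain j where completed: "l = X j" "completion_time X j \<le> T" by blast
  have "j \<le> i"
    using completion_time_mono[OF schedule, of "i + 1" j] completed(2) interval(2)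
    by (cases "j \<le> i") auto
  moreover have "mono X"
    using schedule by (simp add: contract_schedule_def strict_mono_mono)
  ultimately show "l \<le> X i" using completed(1) by (simp add: monoD)
qed

lemma robust_schedule_completion_time_le:
  assumes "robust_schedule r X"
  shows "completion_time X (i + 1) \<le> r * X i"
proof (rule dense_le_bounded)
  have schedule: "contract_schedule X" using assms by (simp add: robust_schedule_def)
  have pos: "0 < X j" for j using schedule by (simp add: contract_schedule_def)
  show "completion_time X i < completion_time X (i + 1)"
    using completion_time_add_1[OF schedule, of i] pos[of "i + 1"] by simp
  fix T assume interval: "completion_time X i < T" "T < completion_time X (i + 1)"
  then have "0 < T" using completion_time_pos[OF schedule, of i] by linarith
  then have "ereal (T / longest_completed X T) \<le> robustness X"
    unfolding robustness_def by (intro SUP_upper) simp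
  also have "\<dots> \<le> ereal r" using assms by (simp add: robust_schedule_def)
  finally show "T \<le> r * X i"
    using longest_completed_eq[OF schedule, of i T] interval pos[of i] by (simp add: field_simps)
qed

lemma completion_time_robust_4:
  assumes "robust_schedule 4 X"
  shows "completion_time X i = completion_time X 0 * 2 powi i"
proof (rule nonneg_int_sequence_geometric)
  have schedule: "contract_schedule X" using assms by (simp add: robust_schedule_def)
  show "0 \<le> completion_time X i" for i using completion_time_pos[OF schedule] by (rule less_imp_le)
  show "completion_time X (i + 1) + 2\<^sup>2 * completion_time X (i - 1) \<le> 2 * 2 * completion_time X i"
    for i
    using robust_schedule_completion_time_le[OF assms, of i] completion_time_add_1[OF schedule, of "i - 1"]
    by simp
qed simp


section \<open>Doubling schedules\<close>

lemma has_sum_atMost_int_iff: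
  "(f has_sum s) {..i :: int} \<longleftrightarrow> ((\<lambda>n. f (i - int n)) has_sum s) UNIV"
proof -
  have "bij_betw (\<lambda>n. i - int n) UNIV {..i}"
    by (rule bij_betw_byWitness[where f' = "\<lambda>j. nat (i - j)"]) auto
  then show ?thesis by (rule has_sum_reindex_bij_betw[symmetric])
qed

lemma has_sum_doubling_schedule:
  "(doubling_schedule \<delta> has_sum 2 powr (of_int i + 1 + \<delta>)) {..i}"
proof -
  have term_eq: "doubling_schedule \<delta> (i - int n) = 2 powr (of_int i + \<delta>) * (1 / 2) ^ n" for n
    by (simp add: doubling_schedule_def powr_add powr_diff powr_realpow field_simps)
  have "(\<lambda>n. 2 powr (of_int i + \<delta>) * (1 / 2) ^ n) sums (2 powr (of_int i + \<delta>) * 2)"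
    using geometric_sums[of "1 / 2 :: real"] by (intro sums_mult) simp
  then have "((\<lambda>n. 2 powr (of_int i + \<delta>) * (1 / 2) ^ n) has_sum (2 powr (of_int i + \<delta>) * 2)) UNIV"
    by (intro sums_nonneg_imp_has_sum) auto
  then show ?thesis by (simp add: has_sum_atMost_int_iff term_eq powr_add mult_ac)
qed

lemma completion_time_doubling_schedule:
  "completion_time (doubling_schedule \<delta>) i = 2 powr (of_int i + 1 + \<delta>)"
  unfolding completion_time_def using has_sum_doubling_schedule by (rule infsumI)

lemma contract_schedule_doubling_schedule: "contract_schedule (doubling_schedule \<delta>)"
  unfolding contract_schedule_def
  using has_sum_doubling_schedule
  by (auto simp: summable_on_def strict_mono_def doubling_schedule_def)

lemma doubling_schedule_ratio:
  assumes "0 < T"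
  shows "T / longest_completed (doubling_schedule \<delta>) T = 2 powr (1 + frac (log 2 T - \<delta>))"
proof -
  define i where "i = \<lfloor>log 2 T - \<delta>\<rfloor> - 1"
  have floor_bounds: "of_int i + 1 + \<delta> \<le> log 2 T" "log 2 T < of_int i + 2 + \<delta>"
    unfolding i_def by linarith+
  have T_eq: "T = 2 powr log 2 T" using assms by simp
  have "longest_completed (doubling_schedule \<delta>) T = doubling_schedule \<delta> i"
  proof (rule longest_completed_eq[OF contract_schedule_doubling_schedule])
    show "completion_time (doubling_schedule \<delta>) i \<le> T"
      unfolding completion_time_doubling_schedule using floor_bounds(1) by (subst T_eq) simp
    show "T < completion_time (doubling_schedule \<delta>) (i + 1)"
      unfolding completion_time_doubling_schedule using floor_bounds(2)
      by (subst T_eq) (simp add: add_ac)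
  qed
  then have "T / longest_completed (doubling_schedule \<delta>) T
      = 2 powr (log 2 T - (of_int i + \<delta>))"
    using assms by (simp add: doubling_schedule_def powr_diff)
  also have "log 2 T - (of_int i + \<delta>) = 1 + frac (log 2 T - \<delta>)"
    by (simp add: i_def frac_def)
  finally show ?thesis .
qed

lemma robust_schedule_doubling_schedule: "robust_schedule 4 (doubling_schedule \<delta>)"
  unfolding robust_schedule_def robustness_def
proof (intro conjI SUP_least contract_schedule_doubling_schedule)
  fix T :: real assume "T \<in> {0<..}"
  then have "T / longest_completed (doubling_schedule \<delta>) T = 2 powr (1 + frac (log 2 T - \<delta>))"
    by (simp add: doubling_schedule_ratio)
  also have "\<dots> \<le> 2 powr 2"
    using frac_lt_1[of "log 2 T - \<delta>"] by (intro powr_mono) auto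
  finally show "ereal (T / longest_completed (doubling_schedule \<delta>) T) \<le> ereal 4" by simp
qed

lemma robust_schedule_4_iff: "robust_schedule 4 X \<longleftrightarrow> (\<exists>\<delta>. X = doubling_schedule \<delta>)"
proof
  assume robust: "robust_schedule 4 X"
  then have schedule: "contract_schedule X" by (simp add: robust_schedule_def)
  define s where "s = completion_time X 0"
  have "0 < s" unfolding s_def using schedule by (rule completion_time_pos)
  have "X i = doubling_schedule (log 2 (s / 2)) i" for i
  proof -
    have "X i = s * 2 powi i - s * 2 powi (i - 1)"
      using completion_time_add_1[OF schedule, of "i - 1"] completion_time_robust_4[OF robust, of i]
        completion_time_robust_4[OF robust, of "i - 1"] by (simp add: s_def)
    also have "\<dots> = 2 powi i * (s / 2)" by (simp add: power_int_diff)
    also have "\<dots> = doubling_schedule (log 2 (s / 2)) i"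
      using \<open>0 < s\<close> by (simp add: doubling_schedule_def powr_add powr_real_of_int')
    finally show ?thesis .
  qed
  then show "\<exists>\<delta>. X = doubling_schedule \<delta>" by blast
qed (auto simp: robust_schedule_doubling_schedule)


section \<open>Phases on the circle\<close>

definition max_phase :: "real set \<Rightarrow> real \<Rightarrow> real" where
  "max_phase A \<alpha> = Max (insert 0 ((\<lambda>x. frac (x - \<alpha>)) ` A))"

lemma max_phase_empty [simp]: "max_phase {} \<alpha> = 0"
  by (simp add: max_phase_def)

lemma max_phase_insert:
  "finite A \<Longrightarrow> max_phase (insert x A) \<alpha> = max (max_phase A \<alpha>) (frac (x - \<alpha>))"
  by (simp add: max_phase_def insert_commute[of 0] max.commute)

lemma max_phase_le_iff:
  "finite A \<Longrightarrow> max_phase A \<alpha> \<le> c \<longleftrightarrow> 0 \<le> c \<and> (\<forall>x\<in>A. frac (x - \<alpha>) \<le> c)"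
  by (simp add: max_phase_def)

lemma max_phase_less_1: "finite A \<Longrightarrow> max_phase A \<alpha> < 1"
  by (auto simp: max_phase_def frac_lt_1)

lemma max_phase_frac [simp]: "max_phase A (frac \<alpha>) = max_phase A \<alpha>"
  by (simp add: max_phase_def frac_diff_simp)

lemma max_phase_attained:
  assumes "finite A" "A \<noteq> {}"
  obtains x where "x \<in> A" "max_phase A \<alpha> = frac (x - \<alpha>)"
proof -
  have "0 \<le> Max ((\<lambda>x. frac (x - \<alpha>)) ` A)" using assms by (auto simp: Max_ge_iff)
  then have "max_phase A \<alpha> = Max ((\<lambda>x. frac (x - \<alpha>)) ` A)"
    using assms by (simp add: max_phase_def)
  also have "\<dots> \<in> (\<lambda>x. frac (x - \<alpha>)) ` A" using assms by (intro Max_in) auto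
  finally show ?thesis using that by blast
qed

lemma ex_max_phase_le:
  assumes "finite A" "A \<noteq> {}"
  shows "\<exists>\<beta>\<in>A. max_phase A \<beta> \<le> max_phase A \<alpha>"
proof -
  obtain \<beta> where "\<beta> \<in> A" and nearest: "\<And>x. x \<in> A \<Longrightarrow> frac (\<beta> - \<alpha>) \<le> frac (x - \<alpha>)"
    using ex_min_if_finite[of "(\<lambda>x. frac (x - \<alpha>)) ` A"] assms by (fastforce simp: not_less)
  have "frac (x - \<beta>) \<le> max_phase A \<alpha>" if "x \<in> A" for x
  proof -
    have "frac (x - \<beta>) = frac (x - \<alpha>) - frac (\<beta> - \<alpha>)"
      using frac_diff_pos[OF nearest[OF that]] by simp
    also have "\<dots> \<le> frac (x - \<alpha>)" by simp
    also have "\<dots> \<le> max_phase A \<alpha>"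
      using max_phase_le_iff[OF assms(1)] that by blast
    finally show ?thesis .
  qed
  then have "max_phase A \<beta> \<le> max_phase A \<alpha>"
    using max_phase_le_iff[OF assms(1)] by blast
  with \<open>\<beta> \<in> A\<close> show ?thesis by blast
qed

text \<open>The value 1, larger than every phase, marks the absence of a candidate.\<close>

definition best_candidate :: "real set \<Rightarrow> real set \<Rightarrow> real \<Rightarrow> real \<Rightarrow> bool" where
  "best_candidate A C v \<beta> \<longleftrightarrow>
     (v = 1 \<or> \<beta> \<in> C \<and> v = max_phase A \<beta>) \<and> (\<forall>\<gamma>\<in>C. v \<le> max_phase A \<gamma>)"

lemma best_candidate_empty: "best_candidate A {} 1 \<beta>"
  by (simp add: best_candidate_def)

lemma best_candidate_insert:
  assumes "best_candidate A C v \<beta>"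
  shows "max_phase A \<gamma> < v \<Longrightarrow> best_candidate A (insert \<gamma> C) (max_phase A \<gamma>) \<gamma>"
    and "\<not> max_phase A \<gamma> < v \<Longrightarrow> best_candidate A (insert \<gamma> C) v \<beta>"
  using assms by (auto simp: best_candidate_def)

lemma max_phase_best_candidate_le:
  assumes "finite A" "best_candidate A A v \<beta>"
  shows "max_phase A \<beta> \<le> max_phase A \<alpha>"
proof (cases "A = {}")
  case False
  then obtain \<gamma> where optimal: "\<gamma> \<in> A" "max_phase A \<gamma> \<le> max_phase A \<alpha>"
    using ex_max_phase_le[OF \<open>finite A\<close>] by blast
  then have "v \<le> max_phase A \<gamma>" using assms(2) by (simp add: best_candidate_def)
  then have "v = max_phase A \<beta>"
    using assms(2) max_phase_less_1[OF \<open>finite A\<close>, of \<gamma>] by (auto simp: best_candidate_def)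
  with \<open>v \<le> max_phase A \<gamma>\<close> optimal(2) show ?thesis by simp
qed simp


section \<open>Consistency of doubling schedules\<close>

lemma consistency_doubling_schedule:
  assumes "finite P" "P \<noteq> {}" and pos: "\<And>\<tau>. \<tau> \<in> P \<Longrightarrow> 0 < \<tau>"
  shows "consistency (doubling_schedule \<delta>) P = ereal (2 powr (1 + max_phase (log 2 ` P) \<delta>))"
proof -
  have fin: "finite (log 2 ` P)" using \<open>finite P\<close> by simp
  obtain x where "x \<in> log 2 ` P" "max_phase (log 2 ` P) \<delta> = frac (x - \<delta>)"
    using max_phase_attained[OF fin] \<open>P \<noteq> {}\<close> by blast
  then obtain \<sigma> where worst: "\<sigma> \<in> P" "max_phase (log 2 ` P) \<delta> = frac (log 2 \<sigma> - \<delta>)"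
    by blast
  show ?thesis
    unfolding consistency_def
  proof (intro antisym SUP_least)
    show "ereal (\<tau> / longest_completed (doubling_schedule \<delta>) \<tau>)
        \<le> ereal (2 powr (1 + max_phase (log 2 ` P) \<delta>))" if "\<tau> \<in> P" for \<tau>
      using max_phase_le_iff[OF fin, of \<delta> "max_phase (log 2 ` P) \<delta>"] pos[OF that] that
      by (simp add: doubling_schedule_ratio)
    show "ereal (2 powr (1 + max_phase (log 2 ` P) \<delta>))
        \<le> (SUP \<tau>\<in>P. ereal (\<tau> / longest_completed (doubling_schedule \<delta>) \<tau>))"
      using worst pos by (intro SUP_upper2[of \<sigma>]) (simp_all add: doubling_schedule_ratio)
  qed
qed

lemma consistency_doubling_schedule_minimal:
  assumes "finite P" and pos: "\<And>\<tau>. \<tau> \<in> P \<Longrightarrow> 0 < \<tau>"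
    and minimal: "\<And>\<alpha>. max_phase (log 2 ` P) \<delta> \<le> max_phase (log 2 ` P) \<alpha>"
    and "robust_schedule 4 Y"
  shows "consistency (doubling_schedule \<delta>) P \<le> consistency Y P"
proof -
  obtain \<alpha> where "Y = doubling_schedule \<alpha>"
    using \<open>robust_schedule 4 Y\<close> robust_schedule_4_iff by blast
  show ?thesis
  proof (cases "P = {}")
    case True
    then show ?thesis by (simp add: consistency_def)
  next
    case False
    with \<open>finite P\<close> pos minimal[of \<alpha>] \<open>Y = doubling_schedule \<alpha>\<close> show ?thesis
      by (simp add: consistency_doubling_schedule)
  qed
qed


section \<open>Total correctness with time bounds\<close>

text \<open>Registers are restored on exit, so that assertions need only speak about the real cells.\<close>

definition runs_within ::
  "(nat \<Rightarrow> nat) \<Rightarrow> com \<Rightarrow> nat \<Rightarrow> (nat \<Rightarrow> real) \<Rightarrow> ((nat \<Rightarrow> real) \<Rightarrow> bool) \<Rightarrow> bool" where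
  "runs_within R c t M Q \<longleftrightarrow> (\<exists>n M'. exec c (R, M) n (R, M') \<and> n \<le> t \<and> Q M')"

lemma runs_within_le: "runs_within R c t M Q \<Longrightarrow> t \<le> t' \<Longrightarrow> runs_within R c t' M Q"
  unfolding runs_within_def by (meson le_trans)

lemma runs_within_mono:
  "runs_within R c t M Q \<Longrightarrow> (\<And>M'. Q M' \<Longrightarrow> Q' M') \<Longrightarrow> runs_within R c t M Q'"
  unfolding runs_within_def by blast

lemma runs_within_Skip: "Q M \<Longrightarrow> runs_within R Skip 1 M Q"
  unfolding runs_within_def by (blast intro: exec.Skip)

lemma runs_within_Real_Const:
  "Q (M(R a := of_int z)) \<Longrightarrow> runs_within R (Real_Const a z) 1 M Q"
  unfolding runs_within_def by (blast intro: exec.Real_Const)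

lemma runs_within_Real_Un:
  "unop_defined f (M (R b)) \<Longrightarrow> Q (M(R a := unop_val f (M (R b)))) \<Longrightarrow>
    runs_within R (Real_Un f a b) 1 M Q"
  unfolding runs_within_def by (blast intro: exec.Real_Un)

lemma runs_within_Real_Bin:
  "binop_defined f (M (R b)) (M (R c)) \<Longrightarrow> Q (M(R a := binop_val f (M (R b)) (M (R c)))) \<Longrightarrow>
    runs_within R (Real_Bin f a b c) 1 M Q"
  unfolding runs_within_def by (blast intro: exec.Real_Bin)

lemma runs_within_Seq:
  assumes "runs_within R c1 t1 M (\<lambda>M'. runs_within R c2 t2 M' Q)"
  shows "runs_within R (Seq c1 c2) (t1 + t2) M Q"
  using assms unfolding runs_within_def by (blast intro: exec.Seq add_mono)

lemma runs_within_If_Then_Else: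
  assumes "test_val b (R, M) \<Longrightarrow> runs_within R c1 t1 M Q"
    and "\<not> test_val b (R, M) \<Longrightarrow> runs_within R c2 t2 M Q"
  shows "runs_within R (If_Then_Else b c1 c2) (Suc (max t1 t2)) M Q"
proof (cases "test_val b (R, M)")
  case True
  then obtain n M' where "exec c1 (R, M) n (R, M')" "n \<le> t1" "Q M'"
    using assms(1) unfolding runs_within_def by blast
  moreover from this have "Suc n \<le> Suc (max t1 t2)" by simp
  ultimately show ?thesis
    unfolding runs_within_def using exec.If_True[OF True] by blast
next
  case False
  then obtain n M' where "exec c2 (R, M) n (R, M')" "n \<le> t2" "Q M'"
    using assms(2) unfolding runs_within_def by blast
  moreover from this have "Suc n \<le> Suc (max t1 t2)" by simp
  ultimately show ?thesis
    unfolding runs_within_def using exec.If_False[OF False] by blast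
qed

lemmas runs_within_intros =
  runs_within_Skip runs_within_Real_Const runs_within_Real_Un runs_within_Real_Bin
  runs_within_Seq runs_within_If_Then_Else

text \<open>The increment 1 is taken from register \<open>u\<close> because additions have no constant operands; the
  final reset of the counter restores the registers.\<close>

definition For :: "nat \<Rightarrow> nat \<Rightarrow> nat \<Rightarrow> com \<Rightarrow> com" where
  "For i n u c = Seq (While (Index_Less i n) (Seq c (Index_Add i i u))) (Index_Const i 0)"

lemma exec_counting_While:
  assumes regs: "R u = 1" "R n = N" and distinct: "n \<noteq> i" "u \<noteq> i"
    and body: "\<And>j M. j < N \<Longrightarrow> I j M \<Longrightarrow> runs_within (R(i := j)) c t M (I (Suc j))"
    and "j \<le> N" "I j M"
  shows "\<exists>m M'. exec (While (Index_Less i n) (Seq c (Index_Add i i u))) (R(i := j), M)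
      m (R(i := N), M') \<and> m \<le> (N - j) * (t + 2) + 1 \<and> I N M'"
  using \<open>j \<le> N\<close> \<open>I j M\<close>
proof (induction j arbitrary: M rule: inc_induct)
  case base
  have "exec (While (Index_Less i n) (Seq c (Index_Add i i u))) (R(i := N), M) 1 (R(i := N), M)"
    using regs distinct by (intro exec.While_False) simp
  moreover have "1 \<le> (N - N) * (t + 2) + 1" by simp
  ultimately show ?case using base by blast
next
  case (step j)
  let ?c = "Seq c (Index_Add i i u)"
  obtain m M' where body_run: "exec c (R(i := j), M) m (R(i := j), M')" "m \<le> t" "I (Suc j) M'"
    using body[OF \<open>j < N\<close> \<open>I j M\<close>] unfolding runs_within_def by blast
  obtain l M'' where
    rest_run: "exec (While (Index_Less i n) ?c) (R(i := Suc j), M') l (R(i := N), M'')"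
      "l \<le> (N - Suc j) * (t + 2) + 1" "I N M''"
    using step.IH[OF body_run(3)] by blast
  have "exec ?c (R(i := j), M) (m + 1) (R(i := Suc j), M')"
    using exec.Seq[OF body_run(1) exec.Index_Add[of i i u]] regs distinct by simp
  then have "exec (While (Index_Less i n) ?c) (R(i := j), M) (Suc (m + 1 + l)) (R(i := N), M'')"
    using regs distinct \<open>j < N\<close> by (intro exec.While_True[OF _ _ rest_run(1)]) simp_all
  moreover have "Suc (m + 1 + l) \<le> (N - j) * (t + 2) + 1"
  proof -
    have "Suc (m + 1 + l) \<le> Suc (N - Suc j) * (t + 2) + 1"
      using body_run(2) rest_run(2) by simp
    then show ?thesis using \<open>j < N\<close> by (simp only: Suc_diff_Suc)
  qed
  ultimately show ?case using rest_run(3) by blast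
qed

lemma runs_within_For:
  assumes regs: "R i = 0" "R u = 1" "R n = N" and distinct: "n \<noteq> i" "u \<noteq> i"
    and init: "I 0 M"
    and body: "\<And>j M. j < N \<Longrightarrow> I j M \<Longrightarrow> runs_within (R(i := j)) c t M (I (Suc j))"
  shows "runs_within R (For i n u c) (N * (t + 2) + 2) M (I N)"
proof -
  have "R(i := 0) = R" using regs(1) by (simp add: fun_upd_idem)
  then obtain m M' where
    loop_run: "exec (While (Index_Less i n) (Seq c (Index_Add i i u))) (R, M) m (R(i := N), M')"
      "m \<le> N * (t + 2) + 1" "I N M'"
    using exec_counting_While[where I = I, OF regs(2,3) distinct body le0 init] by auto
  have "exec (For i n u c) (R, M) (m + 1) (R, M')"
    unfolding For_def using exec.Seq[OF loop_run(1) exec.Index_Const[of i 0]] \<open>R(i := 0) = R\<close>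
    by simp
  with loop_run(2,3) show ?thesis unfolding runs_within_def by force
qed

definition Frac :: "nat \<Rightarrow> nat \<Rightarrow> com" where
  "Frac a b = Seq (Real_Un Floor b a) (Real_Bin Sub a a b)"

lemma runs_within_Frac:
  assumes "R a \<noteq> R b" "Q (M(R b := of_int \<lfloor>M (R a)\<rfloor>, R a := frac (M (R a))))"
  shows "runs_within R (Frac a b) 2 M Q"
proof -
  have "runs_within R (Frac a b) (1 + 1) M Q"
    unfolding Frac_def using assms by (intro runs_within_intros) (simp_all add: frac_def)
  then show ?thesis by (simp only: one_add_one)
qed


section \<open>The program\<close>

abbreviation (input) size_reg :: nat where "size_reg \<equiv> 0"
abbreviation (input) one_reg :: nat where "one_reg \<equiv> 1"
abbreviation (input) candidate_reg :: nat where "candidate_reg \<equiv> 2"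
abbreviation (input) point_reg :: nat where "point_reg \<equiv> 3"
abbreviation (input) phase_reg :: nat where "phase_reg \<equiv> 4"
abbreviation (input) min_phase_reg :: nat where "min_phase_reg \<equiv> 5"
abbreviation (input) best_reg :: nat where "best_reg \<equiv> 6"
abbreviation (input) diff_reg :: nat where "diff_reg \<equiv> 7"
abbreviation (input) floor_reg :: nat where "floor_reg \<equiv> 8"
abbreviation (input) result_reg :: nat where "result_reg \<equiv> 9"

text \<open>The counters \<open>candidate_reg\<close> and \<open>point_reg\<close> also serve as addresses of input cells.
  Registers without an explicit value hold 0, so \<open>result_reg\<close> addresses the result cell.\<close>

definition layout :: "nat \<Rightarrow> nat \<Rightarrow> nat" where
  "layout k = (\<lambda>_. 0)
     (size_reg := k, one_reg := 1, phase_reg := k + 1, min_phase_reg := k + 2, best_reg := k + 3,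
      diff_reg := k + 4, floor_reg := k + 5)"

definition init_registers :: com where
  "init_registers =
     Seq (Index_Const one_reg 1)
    (Seq (Index_Add phase_reg size_reg one_reg)
    (Seq (Index_Add min_phase_reg phase_reg one_reg)
    (Seq (Index_Add best_reg min_phase_reg one_reg)
    (Seq (Index_Add diff_reg best_reg one_reg)
         (Index_Add floor_reg diff_reg one_reg)))))"

definition take_logs :: com where
  "take_logs = For point_reg size_reg one_reg (Real_Un Log2 point_reg point_reg)"

definition update_phase :: com where
  "update_phase =
     Seq (Real_Bin Sub diff_reg point_reg candidate_reg)
    (Seq (Frac diff_reg floor_reg)
         (If_Then_Else (Real_Less phase_reg diff_reg) (Real_Un Copy phase_reg diff_reg) Skip))"

definition try_candidate :: com where
  "try_candidate =
     Seq (Real_Const phase_reg 0)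
    (Seq (For point_reg size_reg one_reg update_phase)
         (If_Then_Else (Real_Less phase_reg min_phase_reg)
           (Seq (Real_Un Copy min_phase_reg phase_reg) (Real_Un Copy best_reg candidate_reg))
           Skip))"

definition find_offset :: com where
  "find_offset =
     Seq (Real_Const min_phase_reg 1)
    (Seq (For candidate_reg size_reg one_reg try_candidate)
    (Seq (Frac best_reg floor_reg)
         (Real_Un Copy result_reg best_reg)))"

definition schedule_program :: com where
  "schedule_program = Seq init_registers (Seq take_logs find_offset)"

definition stores :: "(nat \<Rightarrow> real) \<Rightarrow> real list \<Rightarrow> bool" where
  "stores M xs \<longleftrightarrow> (\<forall>l<length xs. M l = xs ! l)"

lemma stores_nth: "stores M xs \<Longrightarrow> l < length xs \<Longrightarrow> M l = xs ! l"
  by (simp add: stores_def)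

lemma stores_fun_upd_beyond [simp]: "length xs \<le> l \<Longrightarrow> stores (M(l := x)) xs \<longleftrightarrow> stores M xs"
  by (auto simp: stores_def)

definition candidate_invariant :: "real list \<Rightarrow> nat \<Rightarrow> (nat \<Rightarrow> real) \<Rightarrow> bool" where
  "candidate_invariant ys i M \<longleftrightarrow> stores M ys \<and>
     best_candidate (set ys) (set (take i ys)) (M (length ys + 2)) (M (length ys + 3))"

definition phase_invariant :: "real list \<Rightarrow> nat \<Rightarrow> nat \<Rightarrow> (nat \<Rightarrow> real) \<Rightarrow> bool" where
  "phase_invariant ys i j M \<longleftrightarrow> candidate_invariant ys i M \<and>
     M (length ys + 1) = max_phase (set (take j ys)) (ys ! i)"

lemma set_take_Suc: "j < length xs \<Longrightarrow> set (take (Suc j) xs) = insert (xs ! j) (set (take j xs))"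
  by (simp add: take_Suc_conv_app_nth)

lemma exec_init_registers:
  "exec init_registers ((\<lambda>_. 0)(size_reg := k), M) 6 (layout k, M)"
  using exec.Seq[OF exec.Index_Const[of one_reg 1 "(\<lambda>_. 0)(size_reg := k)" M]
      exec.Seq[OF exec.Index_Add[of phase_reg size_reg one_reg]
      exec.Seq[OF exec.Index_Add[of min_phase_reg phase_reg one_reg]
      exec.Seq[OF exec.Index_Add[of best_reg min_phase_reg one_reg]
      exec.Seq[OF exec.Index_Add[of diff_reg best_reg one_reg]
        exec.Index_Add[of floor_reg diff_reg one_reg]]]]]]
  by (simp add: init_registers_def layout_def numeral_eq_Suc)

lemma runs_within_take_logs:
  assumes pos: "\<forall>x\<in>set xs. 0 < x" and "stores M xs"
  shows "runs_within (layout (length xs)) take_logs (3 * length xs + 2) M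
    (\<lambda>M. stores M (map (log 2) xs))"
proof -
  define I where "I j M \<longleftrightarrow> (\<forall>l<length xs. M l = (if l < j then log 2 (xs ! l) else xs ! l))"
    for j and M :: "nat \<Rightarrow> real"
  have "runs_within (layout (length xs)) take_logs (length xs * (1 + 2) + 2) M (I (length xs))"
    unfolding take_logs_def
  proof (rule runs_within_For)
    fix j M assume "j < length xs" "I j M"
    with pos show "runs_within ((layout (length xs))(point_reg := j))
        (Real_Un Log2 point_reg point_reg) 1 M (I (Suc j))"
      by (intro runs_within_Real_Un) (auto simp: I_def less_Suc_eq)
  qed (use \<open>stores M xs\<close> in \<open>simp_all add: layout_def I_def stores_def\<close>)
  then have "runs_within (layout (length xs)) take_logs (3 * length xs + 2) M (I (length xs))"
    by (rule runs_within_le) simp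
  then show ?thesis by (rule runs_within_mono) (simp add: I_def stores_def)
qed

lemma runs_within_update_phase:
  assumes bounds: "i < length ys" "j < length ys" and inv: "phase_invariant ys i j M"
  shows "runs_within ((layout (length ys))(candidate_reg := i, point_reg := j)) update_phase 5 M
    (phase_invariant ys i (Suc j))"
proof -
  have "M i = ys ! i" "M j = ys ! j"
    using inv bounds by (simp_all add: phase_invariant_def candidate_invariant_def stores_nth)
  with bounds inv have "runs_within ((layout (length ys))(candidate_reg := i, point_reg := j))
      update_phase (1 + (2 + Suc (max 1 1))) M (phase_invariant ys i (Suc j))"
    unfolding update_phase_def
    by (intro runs_within_intros runs_within_Frac)
      (auto simp: layout_def phase_invariant_def candidate_invariant_def set_take_Suc
        max_phase_insert)
  then show ?thesis by simp
qed

lemma runs_within_try_candidate: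
  assumes i: "i < length ys" and inv: "candidate_invariant ys i M"
  shows "runs_within ((layout (length ys))(candidate_reg := i)) try_candidate (7 * length ys + 6) M
    (candidate_invariant ys (Suc i))"
proof -
  let ?k = "length ys" and ?R = "(layout (length ys))(candidate_reg := i)"
  let ?update = "If_Then_Else (Real_Less phase_reg min_phase_reg)
    (Seq (Real_Un Copy min_phase_reg phase_reg) (Real_Un Copy best_reg candidate_reg)) Skip"
  have loop: "runs_within ?R (For point_reg size_reg one_reg update_phase) (?k * (5 + 2) + 2)
      (M(?k + 1 := 0)) (phase_invariant ys i ?k)"
  proof (rule runs_within_For)
    show "phase_invariant ys i 0 (M(?k + 1 := 0))"
      using inv by (simp add: phase_invariant_def candidate_invariant_def)
    show "runs_within (?R(point_reg := j)) update_phase 5 M' (phase_invariant ys i (Suc j))"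
      if "j < ?k" "phase_invariant ys i j M'" for j M'
      using i that by (rule runs_within_update_phase)
  qed (simp_all add: layout_def)
  have update: "runs_within ?R ?update (Suc (max (1 + 1) 1)) M' (candidate_invariant ys (Suc i))"
    if inv': "phase_invariant ys i ?k M'" for M'
  proof -
    have "M' i = ys ! i" and phase: "M' (?k + 1) = max_phase (set ys) (ys ! i)"
      and best: "best_candidate (set ys) (set (take i ys)) (M' (?k + 2)) (M' (?k + 3))"
      using inv' i by (simp_all add: phase_invariant_def candidate_invariant_def stores_nth)
    with i inv' best_candidate_insert[OF best, of "ys ! i"] show ?thesis
      by (intro runs_within_intros)
        (auto simp: layout_def phase_invariant_def candidate_invariant_def set_take_Suc)
  qed
  have "runs_within ?R try_candidate (1 + ((?k * (5 + 2) + 2) + Suc (max (1 + 1) 1))) M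
      (candidate_invariant ys (Suc i))"
    unfolding try_candidate_def using runs_within_mono[OF loop update]
    by (intro runs_within_intros) (simp add: layout_def)
  then show ?thesis by (rule runs_within_le) simp
qed

lemma runs_within_find_offset:
  assumes "stores M ys"
  shows "runs_within (layout (length ys)) find_offset (7 * (length ys)\<^sup>2 + 8 * length ys + 6) M
    (\<lambda>M. \<exists>v \<beta>. best_candidate (set ys) (set ys) v \<beta> \<and> M 0 = frac \<beta>)"
proof -
  let ?k = "length ys"
  have loop: "runs_within (layout ?k) (For candidate_reg size_reg one_reg try_candidate)
      (?k * ((7 * ?k + 6) + 2) + 2) (M(?k + 2 := 1)) (candidate_invariant ys ?k)"
  proof (rule runs_within_For)
    show "candidate_invariant ys 0 (M(?k + 2 := 1))"
      using assms by (simp add: candidate_invariant_def best_candidate_empty)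
    show "runs_within ((layout ?k)(candidate_reg := i)) try_candidate (7 * ?k + 6) M'
        (candidate_invariant ys (Suc i))"
      if "i < ?k" "candidate_invariant ys i M'" for i M'
      using that by (rule runs_within_try_candidate)
  qed (simp_all add: layout_def)
  have finish: "runs_within (layout ?k)
      (Seq (Frac best_reg floor_reg) (Real_Un Copy result_reg best_reg))
      (2 + 1) M' (\<lambda>M. \<exists>v \<beta>. best_candidate (set ys) (set ys) v \<beta> \<and> M 0 = frac \<beta>)"
    if "candidate_invariant ys ?k M'" for M'
    using that by (intro runs_within_intros runs_within_Frac)
      (auto simp: layout_def candidate_invariant_def)
  have "runs_within (layout ?k) find_offset (1 + ((?k * ((7 * ?k + 6) + 2) + 2) + (2 + 1))) M
      (\<lambda>M. \<exists>v \<beta>. best_candidate (set ys) (set ys) v \<beta> \<and> M 0 = frac \<beta>)"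
    unfolding find_offset_def using runs_within_mono[OF loop finish]
    by (intro runs_within_intros) (simp add: layout_def)
  then show ?thesis by (rule runs_within_le) (simp add: power2_eq_square algebra_simps)
qed

definition schedule_time :: "nat \<Rightarrow> nat" where
  "schedule_time k = 7 * k\<^sup>2 + 11 * k + 14"

lemma schedule_time_bigo: "(\<lambda>k. real (schedule_time k)) \<in> O(\<lambda>k. real k ^ 2)"
  unfolding schedule_time_def by real_asymp

lemma schedule_program_correct:
  assumes "\<forall>\<tau>\<in>set \<tau>s. 0 < \<tau>"
  obtains n s where "exec schedule_program (input_state \<tau>s) n s"
    "n \<le> schedule_time (length \<tau>s)" "0 \<le> result s" "result s < 1"
    "\<And>\<alpha>. max_phase (log 2 ` set \<tau>s) (result s) \<le> max_phase (log 2 ` set \<tau>s) \<alpha>"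
proof -
  let ?k = "length \<tau>s" and ?ys = "map (log 2) \<tau>s" and ?M = "snd (input_state \<tau>s)"
  have "stores ?M \<tau>s" by (simp add: stores_def input_state_def)
  then have "runs_within (layout ?k) (Seq take_logs find_offset)
      ((3 * ?k + 2) + (7 * ?k\<^sup>2 + 8 * ?k + 6)) ?M
      (\<lambda>M. \<exists>v \<beta>. best_candidate (set ?ys) (set ?ys) v \<beta> \<and> M 0 = frac \<beta>)"
    using runs_within_find_offset[of _ ?ys]
    by (intro runs_within_Seq runs_within_mono[OF runs_within_take_logs[OF assms]]) simp_all
  then obtain m M v \<beta> where run: "exec (Seq take_logs find_offset) (layout ?k, ?M) m (layout ?k, M)"
      and time: "m \<le> (3 * ?k + 2) + (7 * ?k\<^sup>2 + 8 * ?k + 6)"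
      and best: "best_candidate (set ?ys) (set ?ys) v \<beta>" and result: "M 0 = frac \<beta>"
    unfolding runs_within_def by blast
  show ?thesis
  proof (rule that[of "6 + m" "(layout ?k, M)"])
    have "input_state \<tau>s = ((\<lambda>_. 0)(size_reg := ?k), ?M)" by (simp add: input_state_def)
    then show "exec schedule_program (input_state \<tau>s) (6 + m) (layout ?k, M)"
      unfolding schedule_program_def using exec.Seq[OF exec_init_registers run] by simp
    show "6 + m \<le> schedule_time ?k" using time by (simp add: schedule_time_def)
    show "0 \<le> result (layout ?k, M)" "result (layout ?k, M) < 1"
      by (simp_all add: result_def result frac_lt_1)
    show "max_phase (log 2 ` set \<tau>s) (result (layout ?k, M)) \<le> max_phase (log 2 ` set \<tau>s) \<alpha>" for \<alpha>
      using max_phase_best_candidate_le[OF _ best, of \<alpha>] by (simp add: result_def result)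
  qed
qed

theorem theorem5:
  "\<exists>(prog :: com) (time :: nat \<Rightarrow> nat).
     (\<lambda>k. real (time k)) \<in> O(\<lambda>k. real k ^ 2) \<and>
     (\<forall>\<tau>s :: real list. distinct \<tau>s \<and> (\<forall>\<tau>\<in>set \<tau>s. 0 < \<tau>) \<longrightarrow>
       (\<exists>n s. exec prog (input_state \<tau>s) n s \<and> n \<le> time (length \<tau>s) \<and>
          0 \<le> result s \<and> result s < 1 \<and>
          robust_schedule 4 (doubling_schedule (result s)) \<and>
          (\<forall>Y. robust_schedule 4 Y \<longrightarrow>
             consistency (doubling_schedule (result s)) (set \<tau>s) \<le> consistency Y (set \<tau>s))))"
proof (intro exI[of _ schedule_program] exI[of _ schedule_time] conjI schedule_time_bigo allI impI)
  fix \<tau>s :: "real list"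
  assume "distinct \<tau>s \<and> (\<forall>\<tau>\<in>set \<tau>s. 0 < \<tau>)"
  then have pos: "\<forall>\<tau>\<in>set \<tau>s. 0 < \<tau>" by blast
  obtain n s where "exec schedule_program (input_state \<tau>s) n s" "n \<le> schedule_time (length \<tau>s)"
      "0 \<le> result s" "result s < 1"
    and minimal: "\<And>\<alpha>. max_phase (log 2 ` set \<tau>s) (result s) \<le> max_phase (log 2 ` set \<tau>s) \<alpha>"
    using schedule_program_correct[OF pos] by metis
  moreover have "robust_schedule 4 (doubling_schedule (result s))"
    by (rule robust_schedule_doubling_schedule)
  moreover have "consistency (doubling_schedule (result s)) (set \<tau>s) \<le> consistency Y (set \<tau>s)"
    if "robust_schedule 4 Y" for Y
    using pos minimal that by (intro consistency_doubling_schedule_minimal) simp_all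
  ultimately show "\<exists>n s. exec schedule_program (input_state \<tau>s) n s \<and> n \<le> schedule_time (length \<tau>s) \<and>
      0 \<le> result s \<and> result s < 1 \<and> robust_schedule 4 (doubling_schedule (result s)) \<and>
      (\<forall>Y. robust_schedule 4 Y \<longrightarrow>
         consistency (doubling_schedule (result s)) (set \<tau>s) \<le> consistency Y (set \<tau>s))"
    by blast
qed

end
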